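(* Let $\Gamma$ be a simple graph on $V=\{1,\dots,n\}$ with edge ideal $I\subseteq k[x_1,\dots,x_n]$. Let $U\subseteq V$ be a non-empty set such that every connected component of $\Gamma_U$ contains at least one odd cycle, and let $F$ be a cover of $\Gamma$ which is minimal among the covers containing $N[U]$. Assume that $\Gamma_U$ has $m$ connected components, and for $i=1,\dots,m$ let $s_i$ be the largest number such that the $i$-th component of $\Gamma_U$ (in some order) contains, as a subgraph, a strongly $s_i$-saturating graph on $2s_i-1$ vertices. Then $P_F$ is an embedded associated prime of $I^t$ for all $t\ge |U|-\sum_{i=1}^m s_i+1$.
   Context: $k$ is a field, $n\ge 1$. The edge ideal of $\Gamma$ is the ideal generated by the $x_ix_j$ with $\{i,j\}$ an edge of $\Gamma$. A cover of $\Gamma$ is a set of vertices meeting every edge. For $F\subseteq V$, $P_F$ is the ideal generated by the variables $x_i$, $i\in F$. Embedded associated prime means non-minimal associated prime. For $U\subseteq V$, $\Gamma_U$ is the induced subgraph of $\Gamma$ on $U$, and $N[U]$ is the union of $U$ and the set of vertices adjacent to some vertex of $U$ (closed neighborhood). "$F$ is minimal among the covers containing $N$" means that $F$ is a cover containing $N$ and no proper subset of $F$ is a cover containing $N$. For a simple graph $C$ (regarded as a weighted graph with all vertex weights equal to $1$), $\nu(C)$ is the usual matching number (maximal number of pairwise disjoint edges), and $C$ is strongly $s$-saturating if $\nu(C)<s$ and $\nu(C-j)\ge s-1$ for every vertex $j$ of $C$, where $C-j$ is obtained by deleting the vertex $j$. Subgraphs need not be induced. (An odd cycle of length $2s-1$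 is a strongly $s$-saturating graph on $2s-1$ vertices.) *)

theory Defs
  imports "HOL-Library.Poly_Mapping" "HOL-Library.Disjoint_Sets" "HOL-Algebra.Ideal_Product"
begin

section \<open>Finite simple graphs\<close>

record 'v ugraph =
  verts :: "'v set"
  edges :: "'v set set"

definition simple_graph :: "'v ugraph \<Rightarrow> bool" where
  "simple_graph G \<longleftrightarrow> finite (verts G) \<and> (\<forall>e\<in>edges G. e \<subseteq> verts G \<and> card e = 2)"

definition subgraph_of :: "'v ugraph \<Rightarrow> 'v ugraph \<Rightarrow> bool" where
  "subgraph_of H G \<longleftrightarrow> simple_graph H \<and> verts H \<subseteq> verts G \<and> edges H \<subseteq> edges G"

definition induced :: "'v ugraph \<Rightarrow> 'v set \<Rightarrow> 'v ugraph" where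
  "induced G U = \<lparr>verts = U, edges = {e \<in> edges G. e \<subseteq> U}\<rparr>"

definition delete_vertex :: "'v ugraph \<Rightarrow> 'v \<Rightarrow> 'v ugraph" where
  "delete_vertex G j = induced G (verts G - {j})"

definition closed_nbhd :: "'v ugraph \<Rightarrow> 'v set \<Rightarrow> 'v set" where
  "closed_nbhd G U = U \<union> {v \<in> verts G. \<exists>u\<in>U. {u, v} \<in> edges G}"

definition connectedness :: "'v ugraph \<Rightarrow> 'v rel" where
  "connectedness G = {(u, v). {u, v} \<in> edges G}\<^sup>* \<inter> verts G \<times> verts G"

definition components :: "'v ugraph \<Rightarrow> 'v ugraph set" where
  "components G = induced G ` (verts G // connectedness G)"

definition is_cycle :: "'v ugraph \<Rightarrow> 'v list \<Rightarrow> bool" where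
  "is_cycle G xs \<longleftrightarrow> 3 \<le> length xs \<and> distinct xs \<and>
     (\<forall>i<length xs. {xs ! i, xs ! (Suc i mod length xs)} \<in> edges G)"

definition has_odd_cycle :: "'v ugraph \<Rightarrow> bool" where
  "has_odd_cycle G \<longleftrightarrow> (\<exists>xs. is_cycle G xs \<and> odd (length xs))"

definition is_cover :: "'v ugraph \<Rightarrow> 'v set \<Rightarrow> bool" where
  "is_cover G F \<longleftrightarrow> F \<subseteq> verts G \<and> (\<forall>e\<in>edges G. e \<inter> F \<noteq> {})"

definition minimal_cover_containing :: "'v ugraph \<Rightarrow> 'v set \<Rightarrow> 'v set \<Rightarrow> bool" where
  "minimal_cover_containing G N F \<longleftrightarrow>
     is_cover G F \<and> N \<subseteq> F \<and> \<not> (\<exists>F'. F' \<subset> F \<and> is_cover G F' \<and> N \<subseteq> F')"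

definition is_matching :: "'v ugraph \<Rightarrow> 'v set set \<Rightarrow> bool" where
  "is_matching G M \<longleftrightarrow> M \<subseteq> edges G \<and> disjoint M"

definition matching_number :: "'v ugraph \<Rightarrow> nat" (\<open>\<nu>\<close>) where
  "\<nu> G = Max (card ` {M. is_matching G M})"

text \<open>The first condition forces \<open>s \<ge> 1\<close>, so that \<open>s - 1\<close> is not truncated.\<close>
definition strongly_saturating :: "nat \<Rightarrow> 'v ugraph \<Rightarrow> bool" where
  "strongly_saturating s C \<longleftrightarrow>
     \<nu> C < s \<and> (\<forall>j\<in>verts C. \<nu> (delete_vertex C j) \<ge> s - 1)"

definition contains_saturating :: "'v ugraph \<Rightarrow> nat \<Rightarrow> bool" where
  "contains_saturating H s \<longleftrightarrow>
     (\<exists>C. subgraph_of C H \<and> strongly_saturating s C \<and> card (verts C) = 2 * s - 1)"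


section \<open>The polynomial ring and its ideals\<close>

text \<open>A monomial is its exponent vector, of type \<open>'v \<Rightarrow>\<^sub>0 nat\<close>; a polynomial maps monomials
  to coefficients, and the multiplication of the type is convolution.\<close>
type_synonym ('v, 'k) mpoly = "('v \<Rightarrow>\<^sub>0 nat) \<Rightarrow>\<^sub>0 'k"

definition mpoly_ring :: "('v, 'k::field) mpoly ring" where
  "mpoly_ring = \<lparr>carrier = UNIV, mult = (*), one = 1, zero = 0, add = (+)\<rparr>"

definition X :: "'v \<Rightarrow> ('v, 'k::field) mpoly" where
  "X i = Poly_Mapping.single (Poly_Mapping.single i 1) 1"

lemma cring_mpoly_ring: "cring (mpoly_ring :: ('v, 'k::field) mpoly ring)"
proof (rule cringI)
  show "abelian_group (mpoly_ring :: ('v, 'k) mpoly ring)"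
  proof (rule abelian_groupI)
    fix x :: "('v, 'k) mpoly"
    show "\<exists>y\<in>carrier mpoly_ring. y \<oplus>\<^bsub>mpoly_ring\<^esub> x = \<zero>\<^bsub>mpoly_ring\<^esub>"
      by (rule bexI[of _ "- x"]) (simp_all add: mpoly_ring_def)
  qed (simp_all add: mpoly_ring_def algebra_simps)
  show "comm_monoid (mpoly_ring :: ('v, 'k) mpoly ring)"
    by (rule comm_monoidI) (simp_all add: mpoly_ring_def algebra_simps)
qed (simp add: mpoly_ring_def algebra_simps)

definition edge_ideal :: "'v ugraph \<Rightarrow> ('v, 'k::field) mpoly set" where
  "edge_ideal G = Idl\<^bsub>mpoly_ring\<^esub> {X i * X j | i j. {i, j} \<in> edges G}"

definition var_ideal :: "'v set \<Rightarrow> ('v, 'k::field) mpoly set" where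
  "var_ideal F = Idl\<^bsub>mpoly_ring\<^esub> (X ` F)"

text \<open>The power \<open>J\<^sup>t\<close>, taken in the monoid of ideals under the ideal product; \<open>J\<^sup>0\<close> is the whole ring.\<close>
definition ideal_power :: "('a, 'b) ring_scheme \<Rightarrow> 'a set \<Rightarrow> nat \<Rightarrow> 'a set" where
  "ideal_power R J t = J [^]\<^bsub>ideals_set R\<^esub> t"

text \<open>The associated primes of an ideal \<open>J\<close> are those of the module \<open>R/J\<close>: the prime ideals that are
  the annihilator of the residue class of some \<open>f \<in> R\<close>.\<close>
definition associated_primes :: "('a, 'b) ring_scheme \<Rightarrow> 'a set \<Rightarrow> 'a set set" where
  "associated_primes R J =
     {P. primeideal P R \<and> (\<exists>f\<in>carrier R. P = {r \<in> carrier R. r \<otimes>\<^bsub>R\<^esub> f \<in> J})}"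

definition embedded_associated_prime :: "('a, 'b) ring_scheme \<Rightarrow> 'a set \<Rightarrow> 'a set \<Rightarrow> bool" where
  "embedded_associated_prime R J P \<longleftrightarrow>
     P \<in> associated_primes R J \<and> (\<exists>Q\<in>associated_primes R J. Q \<subset> P)"

end

theory Submission
  imports Defs
begin

text \<open>
  All ideals involved are monomial: \<open>I\<^sup>t\<close> is spanned by the monomials divisible by a product of \<open>t\<close>
  edges, and a monomial \<open>f\<close> shows that \<open>P\<^sub>F\<close> is associated to \<open>I\<^sup>t\<close> as soon as \<open>x\<^sub>v f \<in> I\<^sup>t\<close> for \<open>v \<in> F\<close>
  while no multiple of \<open>f\<close> by variables outside \<open>F\<close> lies in \<open>I\<^sup>t\<close>.
  On a component \<open>W\<close> of \<open>\<Gamma>\<^sub>U\<close> with a strongly \<open>s\<close>-saturating subgraph \<open>C\<close> on \<open>2s - 1\<close> vertices, start with the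
  product of the variables of \<open>C\<close> and attach the other vertices one at a time, multiplying by an edge to
  an earlier vertex. The result has odd degree \<open>2(|W| - s) + 1\<close>, hence is divisible by no more than \<open>|W| - s\<close>
  edges, but multiplying by any variable of \<open>N[W]\<close> gives one more edge. The product over all components,
  times a power of an edge inside \<open>U\<close> and all variables outside \<open>F\<close>, is the required \<open>f\<close>.
  The prime is embedded since \<open>F\<close> stays a cover after removing a vertex of \<open>U\<close>, so that it properly
  contains a minimal cover, whose prime is associated to every positive power of \<open>I\<close>.
\<close>

section \<open>Monomial ideals\<close>

lemma mpoly_ring_simps [simp]:
  "carrier mpoly_ring = UNIV" "x \<otimes>\<^bsub>mpoly_ring\<^esub> y = x * y" "x \<oplus>\<^bsub>mpoly_ring\<^esub> y = x + y"
  "\<one>\<^bsub>mpoly_ring\<^esub> = 1" "\<zero>\<^bsub>mpoly_ring\<^esub> = 0"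
  by (simp_all add: mpoly_ring_def)

text \<open>For \<open>S\<close> closed under adding exponent vectors this is the ideal spanned by
  the monomials with exponent in \<open>S\<close>; for other \<open>S\<close> it is only a linear
  subspace.\<close>

definition monomial_ideal :: "('v \<Rightarrow>\<^sub>0 nat) set \<Rightarrow> ('v, 'k::field) mpoly set" where
  "monomial_ideal S = {p. Poly_Mapping.keys p \<subseteq> S}"

lemma mpoly_eq_sum_terms:
  fixes p :: "('v, 'k::field) mpoly"
  shows "p = (\<Sum>a\<in>Poly_Mapping.keys p. Poly_Mapping.single a (Poly_Mapping.lookup p a))"
proof (rule poly_mapping_eqI)
  fix k
  have "(\<Sum>a\<in>Poly_Mapping.keys p. Poly_Mapping.lookup (Poly_Mapping.single a (Poly_Mapping.lookup p a)) k)
      = (\<Sum>a\<in>Poly_Mapping.keys p. if a = k then Poly_Mapping.lookup p k else 0)"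
    by (rule sum.cong) (auto simp: lookup_single when_def)
  then show "Poly_Mapping.lookup p k =
      Poly_Mapping.lookup (\<Sum>a\<in>Poly_Mapping.keys p. Poly_Mapping.single a (Poly_Mapping.lookup p a)) k"
    by (simp add: lookup_sum in_keys_iff)
qed

text \<open>When no other pair of keys sums to \<open>a0 + b0\<close>, the convolution at that
  exponent has at most one non-zero term, so nothing cancels.\<close>

lemma lookup_mult_unique:
  fixes p q :: "('v, 'k::field) mpoly"
  assumes "\<And>a b. a \<in> Poly_Mapping.keys p \<Longrightarrow> b \<in> Poly_Mapping.keys q \<Longrightarrow> a + b = a0 + b0 \<Longrightarrow> a = a0 \<and> b = b0"
  shows "Poly_Mapping.lookup (p * q) (a0 + b0) = Poly_Mapping.lookup p a0 * Poly_Mapping.lookup q b0"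
proof -
  have inner: "Poly_Mapping.lookup p l * (\<Sum>c. Poly_Mapping.lookup q c when a0 + b0 = l + c)
      = (Poly_Mapping.lookup p a0 * Poly_Mapping.lookup q b0 when l = a0)" for l
  proof (cases "l = a0")
    case True
    then show ?thesis by simp
  next
    case False
    have "(Poly_Mapping.lookup q c when a0 + b0 = l + c) = 0" if "Poly_Mapping.lookup p l \<noteq> 0" for c
      using assms[of l c, OF _ _ sym] False that
      by (cases "Poly_Mapping.lookup q c = 0") (auto simp: when_def in_keys_iff)
    with False show ?thesis by (cases "Poly_Mapping.lookup p l = 0") simp_all
  qed
  show ?thesis by (simp add: lookup_mult inner)
qed

lemma ideal_monomial_ideal:
  assumes up: "\<And>a b. a \<in> S \<Longrightarrow> a + b \<in> S"
  shows "ideal (monomial_ideal S) (mpoly_ring :: ('v, 'k::field) mpoly ring)"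
proof -
  interpret cring "mpoly_ring :: ('v, 'k) mpoly ring" by (rule cring_mpoly_ring)
  have l: "r * p \<in> monomial_ideal S" if "p \<in> monomial_ideal S" for r p :: "('v, 'k) mpoly"
    using that keys_mult[of r p] up unfolding monomial_ideal_def
    by (smt (verit, ccfv_SIG) add.commute mem_Collect_eq subset_iff)
  show ?thesis
  proof (rule idealI)
    show "ring (mpoly_ring :: ('v, 'k) mpoly ring)" by (rule ring_axioms)
    show "subgroup (monomial_ideal S) (add_monoid (mpoly_ring :: ('v, 'k) mpoly ring))"
    proof (rule add.subgroupI)
      fix p q :: "('v, 'k) mpoly"
      assume p: "p \<in> monomial_ideal S" and q: "q \<in> monomial_ideal S"
      show "p \<oplus>\<^bsub>mpoly_ring\<^esub> q \<in> monomial_ideal S"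
        using p q keys_add[of p q] by (auto simp: monomial_ideal_def)
      have "\<ominus>\<^bsub>mpoly_ring\<^esub> p = - p"
        by (rule minus_equality) simp_all
      then show "\<ominus>\<^bsub>mpoly_ring\<^esub> p \<in> monomial_ideal S"
        using l[OF p, of "- 1"] by simp
    next
      show "monomial_ideal S \<noteq> ({} :: ('v, 'k) mpoly set)"
        by (auto simp: monomial_ideal_def intro: exI[of _ 0])
    qed simp
  qed (use l in \<open>auto simp: mult.commute\<close>)
qed

lemma ideal_sum_closed:
  assumes "ideal J (mpoly_ring :: ('v, 'k::field) mpoly ring)" "\<And>a. a \<in> A \<Longrightarrow> f a \<in> J"
  shows "(\<Sum>a\<in>A. f a) \<in> J"
proof -
  show ?thesis
    using assms(2)
  proof (induction A rule: infinite_finite_induct)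
    case (insert x A)
    then have "f x \<oplus>\<^bsub>mpoly_ring\<^esub> sum f A \<in> J" 
      by (intro additive_subgroup.a_closed[OF ideal.axioms(1)[OF assms(1)]]) auto
    with insert.hyps show ?case by simp
  qed (use additive_subgroup.zero_closed[OF ideal.axioms(1)[OF assms(1)]] in auto)
qed

text \<open>The exponents on the right are closed under addition, so they define an ideal containing
  the generators. Conversely each term of a member is a generator times a term, and a polynomial is
  the finite sum of its terms.\<close>

lemma genideal_monomials:
  "Idl\<^bsub>mpoly_ring\<^esub> ((\<lambda>a. Poly_Mapping.single a 1) ` A) =
     (monomial_ideal {a + b | a b. a \<in> A} :: ('v, 'k::field) mpoly set)" (is "?I = monomial_ideal ?S")
proof
  interpret cring "mpoly_ring :: ('v, 'k) mpoly ring" by (rule cring_mpoly_ring)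
  have id: "ideal (monomial_ideal ?S) (mpoly_ring :: ('v, 'k) mpoly ring)"
  proof (rule ideal_monomial_ideal)
    fix a b assume "a \<in> ?S"
    then obtain c d where "c \<in> A" "a + b = c + (d + b)" by (auto simp: add.assoc)
    then show "a + b \<in> ?S" by blast
  qed
  have "(\<lambda>a. Poly_Mapping.single a 1) ` A \<subseteq> (monomial_ideal ?S :: ('v, 'k) mpoly set)"
    by (auto simp: monomial_ideal_def) (metis add.right_neutral)
  then show "?I \<subseteq> monomial_ideal ?S"
    by (rule genideal_minimal[OF id])
  have idI: "ideal ?I (mpoly_ring :: ('v, 'k) mpoly ring)"
    by (rule genideal_ideal) simp
  have gen: "Poly_Mapping.single a 1 \<in> ?I" if "a \<in> A" for a
    using genideal_self[of "(\<lambda>a. Poly_Mapping.single a 1) ` A"] that by auto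
  show "monomial_ideal ?S \<subseteq> ?I"
  proof
    fix p :: "('v, 'k) mpoly"
    assume p: "p \<in> monomial_ideal ?S"
    have "Poly_Mapping.single c (Poly_Mapping.lookup p c) \<in> ?I" if c: "c \<in> Poly_Mapping.keys p" for c
    proof -
      obtain a b where ab: "a \<in> A" "c = a + b"
        using p c by (auto simp: monomial_ideal_def)
      have "Poly_Mapping.single a 1 \<otimes>\<^bsub>mpoly_ring\<^esub> Poly_Mapping.single b (Poly_Mapping.lookup p c) \<in> ?I"
        using gen[OF ab(1)] idI by (intro ideal.I_r_closed) auto
      then show ?thesis by (simp add: mult_single ab(2))
    qed
    then have "(\<Sum>c\<in>Poly_Mapping.keys p. Poly_Mapping.single c (Poly_Mapping.lookup p c)) \<in> ?I"
      by (rule ideal_sum_closed[OF idI])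
    then show "p \<in> ?I" by (simp flip: mpoly_eq_sum_terms)
  qed
qed

lemma ideal_prod_monomial_ideal:
  fixes S T :: "('v \<Rightarrow>\<^sub>0 nat) set"
  assumes S: "\<And>a b. a \<in> S \<Longrightarrow> a + b \<in> S" and T: "\<And>a b. a \<in> T \<Longrightarrow> a + b \<in> T"
  shows "ideal_prod mpoly_ring (monomial_ideal S) (monomial_ideal T) =
    (monomial_ideal {a + b | a b. a \<in> S \<and> b \<in> T} :: ('v, 'k::field) mpoly set)" (is "?P = monomial_ideal ?S")
proof
  interpret cring "mpoly_ring :: ('v, 'k) mpoly ring" by (rule cring_mpoly_ring)
  have idP: "ideal ?P (mpoly_ring :: ('v, 'k) mpoly ring)"
    using S T by (intro ideal_prod_is_ideal ideal_monomial_ideal)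
  show "?P \<subseteq> monomial_ideal ?S"
  proof
    fix p assume "p \<in> ?P"
    then show "p \<in> monomial_ideal ?S"
    proof induction
      case (prod i j)
      then show ?case using keys_mult[of i j] by (fastforce simp: monomial_ideal_def)
    next
      case (sum s1 s2)
      then show ?case using keys_add[of s1 s2] by (auto simp: monomial_ideal_def)
    qed
  qed
  show "monomial_ideal ?S \<subseteq> ?P"
  proof
    fix p :: "('v, 'k) mpoly"
    assume p: "p \<in> monomial_ideal ?S"
    have "Poly_Mapping.single c (Poly_Mapping.lookup p c) \<in> ?P" if c: "c \<in> Poly_Mapping.keys p" for c
    proof -
      obtain a b where ab: "a \<in> S" "b \<in> T" "c = a + b"
        using p c by (auto simp: monomial_ideal_def)
      have "Poly_Mapping.single a 1 \<otimes>\<^bsub>mpoly_ring\<^esub> Poly_Mapping.single b (Poly_Mapping.lookup p c) \<in> ?P"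
        using ab by (intro ideal_prod.prod) (auto simp: monomial_ideal_def)
      then show ?thesis by (simp add: mult_single ab(3))
    qed
    then have "(\<Sum>c\<in>Poly_Mapping.keys p. Poly_Mapping.single c (Poly_Mapping.lookup p c)) \<in> ?P"
      by (rule ideal_sum_closed[OF idP])
    then show "p \<in> ?P" by (simp flip: mpoly_eq_sum_terms)
  qed
qed

section \<open>Exponent vectors of the powers of the edge ideal\<close>

lemma keys_add_nat: "Poly_Mapping.keys (a + b) = Poly_Mapping.keys a \<union> Poly_Mapping.keys (b :: 'v \<Rightarrow>\<^sub>0 nat)"
  by (auto simp: in_keys_iff lookup_add)

definition unit_vec :: "'v \<Rightarrow> 'v \<Rightarrow>\<^sub>0 nat" where
  "unit_vec v = Poly_Mapping.single v 1"

lemma lookup_unit_vec [simp]: "Poly_Mapping.lookup (unit_vec v) w = (if v = w then 1 else 0)"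
  by (simp add: unit_vec_def lookup_single when_def)

lemma unit_vec_split:
  assumes "Poly_Mapping.lookup a v \<noteq> 0"
  shows "a = unit_vec v + (a - unit_vec v)"
  using assms by (intro poly_mapping_eqI) (auto simp: lookup_add lookup_minus)

text \<open>These are the exponents of the monomials divisible by a product of \<open>t\<close>
  edges, repetitions allowed. Starting from \<open>UNIV\<close> instead of the zero vector builds in
  closure under multiples.\<close>

fun edge_power :: "'v ugraph \<Rightarrow> nat \<Rightarrow> ('v \<Rightarrow>\<^sub>0 nat) set" where
  "edge_power G 0 = UNIV"
| "edge_power G (Suc t) = {a + (unit_vec i + unit_vec j) | a i j. a \<in> edge_power G t \<and> {i, j} \<in> edges G}"

lemma edge_power_add: "a \<in> edge_power G t \<Longrightarrow> a + b \<in> edge_power G t"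
proof (induction t arbitrary: a)
  case (Suc t)
  then obtain c i j where "c \<in> edge_power G t" "{i, j} \<in> edges G" "a = c + (unit_vec i + unit_vec j)"
    by auto
  moreover have "c + b \<in> edge_power G t" using Suc.IH calculation(1) .
  moreover have "a + b = (c + b) + (unit_vec i + unit_vec j)"
    using calculation(3) by (simp add: ac_simps)
  ultimately show ?case by auto
qed simp

lemma edge_ideal_eq:
  "edge_ideal G = (monomial_ideal (edge_power G (Suc 0)) :: ('v, 'k::field) mpoly set)"
proof -
  have "{X i * X j | i j. {i, j} \<in> edges G} =
      (\<lambda>a. Poly_Mapping.single a (1::'k)) ` {unit_vec i + unit_vec j | i j. {i, j} \<in> edges G}"
    by (auto simp: X_def unit_vec_def mult_single)
  moreover have "edge_power G (Suc 0) = {a + b | a b. a \<in> {unit_vec i + unit_vec j | i j. {i, j} \<in> edges G}}"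
    by (auto; metis add.commute)
  ultimately show ?thesis by (simp only: edge_ideal_def genideal_monomials)
qed

lemma ideal_power_edge_ideal:
  "ideal_power mpoly_ring (edge_ideal G) t = (monomial_ideal (edge_power G t) :: ('v, 'k::field) mpoly set)"
proof (induction t)
  case 0
  then show ?case by (simp add: ideal_power_def nat_pow_def ideals_set_def monomial_ideal_def)
next
  case (Suc t)
  have "edge_power G (Suc t) = {a + b | a b. a \<in> edge_power G t \<and> b \<in> edge_power G (Suc 0)}"
  proof -
    \<comment> \<open>A degree-one factor is an edge plus a remainder \<open>b\<close>; the
      remainder is absorbed into \<open>a\<close>.\<close>
    have "a + (b + c) \<in> edge_power G (Suc t)"
      if "a \<in> edge_power G t" "c = unit_vec i + unit_vec j" "{i, j} \<in> edges G" for a b c i j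
    proof -
      have "a + b \<in> edge_power G t" using that by (intro edge_power_add)
      moreover have "a + (b + c) = (a + b) + (unit_vec i + unit_vec j)"
        using that(2) by (simp add: ac_simps)
      ultimately show ?thesis using that(3) by auto
    qed
    moreover have "edge_power G (Suc t) \<subseteq> {a + b | a b. a \<in> edge_power G t \<and> b \<in> edge_power G (Suc 0)}"
      by auto (metis add_0)
    ultimately show ?thesis by fastforce
  qed
  moreover have "ideal_power mpoly_ring (edge_ideal G) (Suc t) =
      ideal_prod mpoly_ring (monomial_ideal (edge_power G t)) (monomial_ideal (edge_power G (Suc 0)) :: ('v, 'k) mpoly set)"
    using Suc by (simp add: ideal_power_def nat_pow_def ideals_set_def edge_ideal_eq del: edge_power.simps)
  ultimately show ?case
    by (simp only: ideal_prod_monomial_ideal edge_power_add)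
qed

lemma var_ideal_eq:
  "var_ideal F = (monomial_ideal {a. Poly_Mapping.keys a \<inter> F \<noteq> {}} :: ('v, 'k::field) mpoly set)"
proof -
  have "X ` F = (\<lambda>a. Poly_Mapping.single a (1::'k)) ` (unit_vec ` F)"
    by (auto simp: X_def unit_vec_def image_image)
  moreover have "{a + b | a b. a \<in> unit_vec ` F} = {a. Poly_Mapping.keys a \<inter> F \<noteq> {}}"
  proof (intro subset_antisym subsetI)
    fix a :: "'v \<Rightarrow>\<^sub>0 nat" assume "a \<in> {a. Poly_Mapping.keys a \<inter> F \<noteq> {}}"
    then obtain v where v: "v \<in> F" "Poly_Mapping.lookup a v \<noteq> 0" by (auto simp: in_keys_iff)
    with unit_vec_split[of a v] show "a \<in> {a + b | a b. a \<in> unit_vec ` F}" by blast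
  qed (auto simp: in_keys_iff lookup_add)
  ultimately show ?thesis by (simp only: var_ideal_def genideal_monomials)
qed

section \<open>Variable ideals as associated primes\<close>

text \<open>The weights are powers of \<open>B\<close>, so that the sums are base-\<open>B\<close> expansions.\<close>
lemma ex_separating_weight:
  assumes "finite S"
  shows "\<exists>c :: 'v \<Rightarrow> nat. \<forall>a b. (\<forall>i\<in>S. a i < B \<and> b i < B) \<longrightarrow>
    (\<Sum>i\<in>S. c i * a i) = (\<Sum>i\<in>S. c i * b i) \<longrightarrow> (\<forall>i\<in>S. a i = b i)"
  using assms
proof induction
  case (insert x S)
  then obtain c :: "'v \<Rightarrow> nat" where c: "\<forall>a b. (\<forall>i\<in>S. a i < B \<and> b i < B) \<longrightarrow>
    (\<Sum>i\<in>S. c i * a i) = (\<Sum>i\<in>S. c i * b i) \<longrightarrow> (\<forall>i\<in>S. a i = b i)" by blast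
  define d where "d = (\<lambda>i. if i = x then 1 else B * c i)"
  have d: "(\<Sum>i\<in>insert x S. d i * a i) = a x + B * (\<Sum>i\<in>S. c i * a i)" for a :: "'v \<Rightarrow> nat"
  proof -
    have "(\<Sum>i\<in>S. d i * a i) = (\<Sum>i\<in>S. B * (c i * a i))"
      using insert.hyps by (intro sum.cong) (auto simp: d_def)
    then show ?thesis using insert.hyps by (simp add: d_def sum_distrib_left)
  qed
  have "\<forall>i\<in>insert x S. a i = b i" if lt: "\<forall>i\<in>insert x S. a i < B \<and> b i < B"
    and eq: "(\<Sum>i\<in>insert x S. d i * a i) = (\<Sum>i\<in>insert x S. d i * b i)" for a b
  proof -
    have *: "a x + B * (\<Sum>i\<in>S. c i * a i) = b x + B * (\<Sum>i\<in>S. c i * b i)"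
      using eq by (simp only: d)
    have "a x = b x"
      using arg_cong[OF *, of "\<lambda>z. z mod B"] lt by simp
    moreover have "(\<Sum>i\<in>S. c i * a i) = (\<Sum>i\<in>S. c i * b i)"
      using * lt calculation by auto
    ultimately show ?thesis using c[rule_format, of a b] lt by blast
  qed
  then show ?case by blast
qed simp

text \<open>A base \<open>B\<close> above all exponents occurring in \<open>K\<close> turns them
  into digits, so distinct members of \<open>K\<close> get distinct weights. Such an additive weight
  stands in for a monomial order on a finite set of monomials.\<close>

lemma ex_injective_monomial_weight:
  fixes K :: "('v::finite \<Rightarrow>\<^sub>0 nat) set"
  assumes "finite K"
  shows "\<exists>w :: ('v \<Rightarrow>\<^sub>0 nat) \<Rightarrow> nat. (\<forall>a b. w (a + b) = w a + w b) \<and> inj_on w K"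
proof -
  define B where "B = Suc (\<Sum>a\<in>K. \<Sum>i\<in>UNIV. Poly_Mapping.lookup a i)"
  have lt: "Poly_Mapping.lookup a i < B" if "a \<in> K" for a i
  proof -
    have "Poly_Mapping.lookup a i \<le> (\<Sum>i\<in>UNIV. Poly_Mapping.lookup a i)"
      by (rule member_le_sum) auto
    also have "\<dots> \<le> (\<Sum>a\<in>K. \<Sum>i\<in>UNIV. Poly_Mapping.lookup a i)"
      using assms that by (intro member_le_sum[of a K]) auto
    finally show ?thesis by (simp add: B_def)
  qed
  obtain c :: "'v \<Rightarrow> nat" where c: "\<And>a b. (\<forall>i\<in>UNIV. a i < B \<and> b i < B) \<Longrightarrow>
    (\<Sum>i\<in>UNIV. c i * a i) = (\<Sum>i\<in>UNIV. c i * b i) \<Longrightarrow> (\<forall>i\<in>UNIV. a i = b i)"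
    using ex_separating_weight[of "UNIV :: 'v set" B] by auto
  define w where "w = (\<lambda>a. \<Sum>i\<in>UNIV. c i * Poly_Mapping.lookup a i)"
  have "inj_on w K"
    unfolding w_def
    by (intro inj_onI poly_mapping_eqI) (use c lt in blast)
  moreover have "w (a + b) = w a + w b" for a b
    by (simp add: w_def lookup_add distrib_left sum.distrib)
  ultimately show ?thesis by blast
qed

lemma primeideal_var_ideal:
  "primeideal (var_ideal F) (mpoly_ring :: ('v::finite, 'k::field) mpoly ring)"
proof (rule primeidealI)
  show "ideal (var_ideal F) (mpoly_ring :: ('v, 'k) mpoly ring)"
    unfolding var_ideal_eq by (rule ideal_monomial_ideal) (auto simp: in_keys_iff lookup_add)
  show "cring (mpoly_ring :: ('v, 'k) mpoly ring)" by (rule cring_mpoly_ring)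
  show "carrier mpoly_ring \<noteq> (var_ideal F :: ('v, 'k) mpoly set)"
  proof -
    have "(1 :: ('v, 'k) mpoly) \<notin> var_ideal F" by (simp add: var_ideal_eq monomial_ideal_def)
    then show ?thesis by auto
  qed
next
  fix p q :: "('v, 'k) mpoly"
  assume "p \<otimes>\<^bsub>mpoly_ring\<^esub> q \<in> var_ideal F"
  then have pq: "p * q \<in> var_ideal F" by simp
  show "p \<in> var_ideal F \<or> q \<in> var_ideal F"
  proof (rule ccontr)
    assume neg: "\<not> (p \<in> var_ideal F \<or> q \<in> var_ideal F)"
    txt \<open>Compare the terms without a variable of \<open>F\<close> that have the largest weight: their product cannot cancel.\<close>
    define A where "A = (\<lambda>r :: ('v, 'k) mpoly. {a \<in> Poly_Mapping.keys r. Poly_Mapping.keys a \<inter> F = {}})"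
    have A: "finite (A p)" "finite (A q)" "A p \<noteq> {}" "A q \<noteq> {}"
      using neg by (auto simp: A_def var_ideal_eq monomial_ideal_def)
    obtain w :: "('v \<Rightarrow>\<^sub>0 nat) \<Rightarrow> nat" where
      w: "\<And>a b. w (a + b) = w a + w b" and inj: "inj_on w (A p \<union> A q)"
      using ex_injective_monomial_weight[of "A p \<union> A q"] A by auto
    obtain a0 where a0: "a0 \<in> A p" "\<And>a. a \<in> A p \<Longrightarrow> w a \<le> w a0"
      using Max_in[of "w ` A p"] Max_ge[of "w ` A p"] A by (smt (verit) finite_imageI imageE image_eqI image_is_empty)
    obtain b0 where b0: "b0 \<in> A q" "\<And>b. b \<in> A q \<Longrightarrow> w b \<le> w b0"
      using Max_in[of "w ` A q"] Max_ge[of "w ` A q"] A by (smt (verit) finite_imageI imageE image_eqI image_is_empty)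
    have noF: "Poly_Mapping.keys (a0 + b0) \<inter> F = {}"
      using a0(1) b0(1) by (auto simp: A_def keys_add_nat)
    have "Poly_Mapping.lookup (p * q) (a0 + b0) = Poly_Mapping.lookup p a0 * Poly_Mapping.lookup q b0"
    proof (rule lookup_mult_unique)
      fix a b
      assume ab: "a \<in> Poly_Mapping.keys p" "b \<in> Poly_Mapping.keys q" "a + b = a0 + b0"
      \<comment> \<open>Exponents are natural numbers, so a sum avoids \<open>F\<close> only if both
        summands do.\<close>
      have "Poly_Mapping.keys (a + b) \<inter> F = {}" using noF ab(3) by simp
      then have mem: "a \<in> A p" "b \<in> A q"
        using ab(1,2) by (auto simp: A_def keys_add_nat)
      have "w a + w b = w a0 + w b0" using ab(3) w by metis
      \<comment> \<open>Both \<open>w a0\<close> and \<open>w b0\<close> are maximal, so equal sums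
        leave no slack in either summand.\<close>
      then have "w a = w a0" "w b = w b0" using a0(2)[OF mem(1)] b0(2)[OF mem(2)] by auto
      then show "a = a0 \<and> b = b0" using inj mem a0(1) b0(1) by (meson UnI1 UnI2 inj_onD)
    qed
    also have "\<dots> \<noteq> 0" using a0(1) b0(1) by (auto simp: A_def in_keys_iff)
    finally have "a0 + b0 \<in> Poly_Mapping.keys (p * q)" by (simp add: in_keys_iff)
    then show False using pq noF by (auto simp: var_ideal_eq monomial_ideal_def)
  qed
qed

section \<open>Annihilators of monomials\<close>

lemma keys_mult_monomial:
  fixes p :: "('v, 'k::field) mpoly"
  shows "Poly_Mapping.keys (p * Poly_Mapping.single a 1) = (\<lambda>b. b + a) ` Poly_Mapping.keys p"
proof
  show "Poly_Mapping.keys (p * Poly_Mapping.single a 1) \<subseteq> (\<lambda>b. b + a) ` Poly_Mapping.keys p"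
    using keys_mult[of p "Poly_Mapping.single a 1"] by auto
  have "Poly_Mapping.lookup (p * Poly_Mapping.single a 1) (b + a) = Poly_Mapping.lookup p b" for b
    by (subst lookup_mult_unique) auto
  then show "(\<lambda>b. b + a) ` Poly_Mapping.keys p \<subseteq> Poly_Mapping.keys (p * Poly_Mapping.single a 1)"
    by (auto simp: in_keys_iff)
qed

text \<open>The annihilator of a monomial modulo a monomial ideal is again a monomial ideal, so it
  is compared with \<open>var_ideal F\<close> exponent by exponent: the first assumption settles
  those meeting \<open>F\<close>, the second those avoiding it.\<close>

lemma var_ideal_associated_primeI:
  fixes a :: "'v::finite \<Rightarrow>\<^sub>0 nat"
  assumes in_power: "\<And>v. v \<in> F \<Longrightarrow> a + unit_vec v \<in> edge_power G t"
    and not_in_power: "\<And>b. Poly_Mapping.keys b \<inter> F = {} \<Longrightarrow> a + b \<notin> edge_power G t"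
  shows "var_ideal F \<in> associated_primes (mpoly_ring :: ('v, 'k::field) mpoly ring)
    (ideal_power mpoly_ring (edge_ideal G) t)"
proof -
  have *: "b + a \<in> edge_power G t \<longleftrightarrow> Poly_Mapping.keys b \<inter> F \<noteq> {}" for b
  proof
    assume "Poly_Mapping.keys b \<inter> F \<noteq> {}"
    then obtain v where v: "v \<in> F" "Poly_Mapping.lookup b v \<noteq> 0" by (auto simp: in_keys_iff)
    have "b + a = (a + unit_vec v) + (b - unit_vec v)"
      by (subst unit_vec_split[OF v(2)]) (simp add: ac_simps)
    then show "b + a \<in> edge_power G t" using edge_power_add[OF in_power[OF v(1)]] by metis
  qed (use not_in_power[of b] in \<open>auto simp: add.commute\<close>)
  have "var_ideal F = {r \<in> carrier (mpoly_ring :: ('v, 'k) mpoly ring).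
      r \<otimes>\<^bsub>mpoly_ring\<^esub> Poly_Mapping.single a 1 \<in> ideal_power mpoly_ring (edge_ideal G) t}"
    by (auto simp: ideal_power_edge_ideal var_ideal_eq monomial_ideal_def keys_mult_monomial * image_subset_iff)
  then show ?thesis
    unfolding associated_primes_def using primeideal_var_ideal[of F, where 'k = 'k] by (simp del: mpoly_ring_simps) (use mpoly_ring_simps(1) in blast)
qed

section \<open>Monomials divisible by many edges\<close>

lemma edge_power_mult:
  "a \<in> edge_power G s \<Longrightarrow> b \<in> edge_power G t \<Longrightarrow> a + b \<in> edge_power G (s + t)"
proof (induction t arbitrary: b)
  case (Suc t)
  then obtain c i j where c: "c \<in> edge_power G t" "{i, j} \<in> edges G" "b = c + (unit_vec i + unit_vec j)"
    by auto
  then have "a + c \<in> edge_power G (s + t)" using Suc by blast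
  moreover have "a + b = (a + c) + (unit_vec i + unit_vec j)" using c(3) by (simp add: ac_simps)
  ultimately show ?case using c(2) by auto
qed (simp add: edge_power_add)

lemma edge_power_sum:
  assumes "\<And>i. i \<in> A \<Longrightarrow> f i \<in> edge_power G (k i)"
  shows "(\<Sum>i\<in>A. f i) \<in> edge_power G (\<Sum>i\<in>A. k i)"
  using assms by (induction A rule: infinite_finite_induct) (auto simp: edge_power_mult)

lemma edge_power_edge: "{i, j} \<in> edges G \<Longrightarrow> unit_vec i + unit_vec j \<in> edge_power G 1"
  by auto (metis add_0)

text \<open>The edges of a matching partition its vertex set, so the squarefree monomial on that set
  is the product of the edges.\<close>

lemma edge_power_matching:
  assumes "finite M" "disjoint M" and M: "\<And>e. e \<in> M \<Longrightarrow> e \<in> edges G \<and> card e = 2"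
  shows "(\<Sum>v\<in>\<Union>M. unit_vec v) \<in> edge_power G (card M)"
proof -
  have "(\<Sum>v\<in>e. unit_vec v) \<in> edge_power G 1" if "e \<in> M" for e
  proof -
    obtain i j where ij: "e = {i, j}" "i \<noteq> j" using M[of e] \<open>e \<in> M\<close> by (auto simp: card_2_iff)
    with M[of e] \<open>e \<in> M\<close> show ?thesis using edge_power_edge[of i j G] by simp
  qed
  then have "(\<Sum>e\<in>M. \<Sum>v\<in>e. unit_vec v) \<in> edge_power G (\<Sum>e\<in>M. 1)"
    by (rule edge_power_sum)
  moreover have "(\<Sum>v\<in>\<Union>M. unit_vec v) = (\<Sum>e\<in>M. \<Sum>v\<in>e. unit_vec v)"
    using assms(2) M card_ge_0_finite[where 'a = 'a]
    by (subst sum.Union_disjoint) (auto simp: disjoint_def)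
  ultimately show ?thesis by simp
qed

lemma card_Union_matching:
  assumes "disjoint M" "\<And>e. e \<in> M \<Longrightarrow> card e = 2"
  shows "card (\<Union>M) = 2 * card M"
proof -
  have "card (\<Union>M) = sum card M"
    using assms by (intro card_Union_disjoint) (auto simp: disjoint_def pairwise_def disjnt_def card_2_iff)
  then show ?thesis using assms(2) by (simp add: mult.commute)
qed

text \<open>A matching of \<open>C - j\<close> with at least \<open>s - 1\<close> edges already
  covers \<open>2 * s - 2\<close> vertices, which is all of them. Thus \<open>C\<close> is
  factor-critical.\<close>

lemma strongly_saturating_perfect_matching:
  fixes C :: "'v::finite ugraph"
  assumes "simple_graph C" "strongly_saturating s C" "card (verts C) = 2 * s - 1" "j \<in> verts C"
  obtains M where "M \<subseteq> edges C" "disjoint M" "card M = s - 1" "\<Union>M = verts C - {j}"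
proof -
  have "card ` {M. is_matching (delete_vertex C j) M} \<noteq> {}"
    by (auto simp: is_matching_def intro!: exI[of _ "{}"])
  then have "\<nu> (delete_vertex C j) \<in> card ` {M. is_matching (delete_vertex C j) M}"
    unfolding matching_number_def by (intro Max_in) auto
  then obtain M where M: "is_matching (delete_vertex C j) M" "card M \<ge> s - 1"
    using assms by (auto simp: strongly_saturating_def)
  then have sub: "M \<subseteq> edges C" "disjoint M" "\<Union>M \<subseteq> verts C - {j}"
    by (auto simp: is_matching_def delete_vertex_def induced_def)
  have "card (\<Union>M) = 2 * card M"
    using sub assms(1) by (intro card_Union_matching) (auto simp: simple_graph_def)
  moreover have "card (\<Union>M) \<le> card (verts C - {j})"
    using sub(3) by (intro card_mono) auto
  moreover have "card (verts C - {j}) = 2 * s - 2" using assms by simp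
  ultimately have "card M = s - 1" "\<Union>M = verts C - {j}"
    using M(2) card_subset_eq[OF _ sub(3)] by simp_all
  with sub that show thesis by blast
qed

section \<open>Degrees on a vertex set\<close>

definition vdeg :: "'v set \<Rightarrow> ('v \<Rightarrow>\<^sub>0 nat) \<Rightarrow> nat" where
  "vdeg W a = (\<Sum>v\<in>W. Poly_Mapping.lookup a v)"

lemma vdeg_add: "vdeg W (a + b) = vdeg W a + vdeg W b"
  by (simp add: vdeg_def lookup_add sum.distrib)

lemma vdeg_0 [simp]: "vdeg W 0 = 0"
  by (simp add: vdeg_def)

lemma vdeg_sum: "vdeg W (\<Sum>i\<in>A. f i) = (\<Sum>i\<in>A. vdeg W (f i))"
  by (induction A rule: infinite_finite_induct) (auto simp: vdeg_add)

lemma vdeg_unit_vec [simp]: "vdeg (W :: 'v::finite set) (unit_vec v) = (if v \<in> W then 1 else 0)"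
  by (simp add: vdeg_def)

lemma vdeg_eq_0: "Poly_Mapping.keys a \<inter> W = {} \<Longrightarrow> vdeg W a = 0"
  unfolding vdeg_def by (intro sum.neutral) (auto simp: in_keys_iff)

lemma keys_sum_nat:
  "Poly_Mapping.keys (\<Sum>i\<in>A. f i :: 'v \<Rightarrow>\<^sub>0 nat) \<subseteq> (\<Union>i\<in>A. Poly_Mapping.keys (f i))"
  by (induction A rule: infinite_finite_induct) (auto simp: keys_add_nat)

lemma keys_unit_vec [simp]: "Poly_Mapping.keys (unit_vec v) = {v}"
  by (simp add: unit_vec_def)

section \<open>Critical monomials\<close>

text \<open>The odd degree leaves room for only \<open>k\<close> edges, with one variable to spare;
  still, every variable of the closed neighbourhood completes a further edge.\<close>

definition critical :: "'v ugraph \<Rightarrow> 'v set \<Rightarrow> nat \<Rightarrow> ('v \<Rightarrow>\<^sub>0 nat) \<Rightarrow> bool" where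
  "critical G W k a \<longleftrightarrow> Poly_Mapping.keys a \<subseteq> W \<and> vdeg W a = 2 * k + 1 \<and> a \<in> edge_power G k \<and>
     (\<forall>v\<in>closed_nbhd G W. a + unit_vec v \<in> edge_power G (Suc k))"

text \<open>For \<open>v\<close> in the closed neighbourhood, pick \<open>j\<close> in
  \<open>C\<close> adjacent to \<open>v\<close>: a perfect matching of \<open>C - j\<close> together
  with the edge \<open>{j, v}\<close> gives \<open>s\<close> edges.\<close>

lemma critical_saturating:
  fixes G C :: "'v::finite ugraph"
  assumes C: "simple_graph C" "edges C \<subseteq> edges G" "strongly_saturating s C"
      "card (verts C) = 2 * s - 1" and s: "s \<ge> 2"
  shows "critical G (verts C) (s - 1) (\<Sum>v\<in>verts C. unit_vec v)"
proof -
  let ?a = "\<Sum>v\<in>verts C. unit_vec v"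
  have del: "(\<Sum>v\<in>verts C - {j}. unit_vec v) \<in> edge_power G (s - 1)" if j: "j \<in> verts C" for j
  proof -
    obtain M where M: "M \<subseteq> edges C" "disjoint M" "card M = s - 1" "\<Union>M = verts C - {j}"
      by (rule strongly_saturating_perfect_matching[OF C(1,3,4) j])
    have "e \<in> edges G \<and> card e = 2" if "e \<in> M" for e
      using that M(1) C(1,2) by (auto simp: simple_graph_def)
    then show ?thesis
      using edge_power_matching[of M G] M by simp
  qed
  have a: "?a = unit_vec j + (\<Sum>v\<in>verts C - {j}. unit_vec v)" if "j \<in> verts C" for j
    using that by (simp add: sum.remove)
  txt \<open>A perfect matching of \<open>C - i\<close> with \<open>i \<noteq> v\<close> provides a neighbour of \<open>v\<close>.\<close>
  have nb: "\<exists>j\<in>verts C. {j, v} \<in> edges C" if v: "v \<in> verts C" for v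
  proof -
    have "verts C - {v} \<noteq> {}"
    proof
      assume "verts C - {v} = {}"
      then have "card (verts C) \<le> card {v}" by (intro card_mono) auto
      then show False using C(4) s by simp
    qed
    then obtain i where i: "i \<in> verts C" "i \<noteq> v" by blast
    obtain M where M: "M \<subseteq> edges C" "\<Union>M = verts C - {i}"
      by (rule strongly_saturating_perfect_matching[OF C(1,3,4) i(1)])
    then obtain e where e: "e \<in> M" "v \<in> e" using v i by blast
    then have "card e = 2" "e \<subseteq> verts C" "e \<in> edges C" using M C(1) by (auto simp: simple_graph_def)
    then obtain j where "e = {j, v}" using e(2) by (auto simp: card_2_iff)
    then show ?thesis using \<open>e \<subseteq> verts C\<close> \<open>e \<in> edges C\<close> by auto
  qed
  have "?a + unit_vec v \<in> edge_power G s" if v: "v \<in> closed_nbhd G (verts C)" for v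
  proof -
    obtain j where j: "j \<in> verts C" "{j, v} \<in> edges G"
    proof (cases "v \<in> verts C")
      case True
      then show thesis using nb[of v] C(2) that by auto
    next
      case False
      then show thesis using v that by (auto simp: closed_nbhd_def)
    qed
    have "(\<Sum>v\<in>verts C - {j}. unit_vec v) + (unit_vec j + unit_vec v) \<in> edge_power G (s - 1 + 1)"
      using del[OF j(1)] edge_power_edge[OF j(2)] by (rule edge_power_mult)
    then show ?thesis using s by (simp add: a[OF j(1)] ac_simps del: edge_power.simps)
  qed
  moreover have "?a \<in> edge_power G (s - 1)"
  proof -
    obtain j where j: "j \<in> verts C" using C(4) s by fastforce
    then show ?thesis using edge_power_add[OF del[OF j], of "unit_vec j"] by (simp add: a[OF j] add.commute)
  qed
  moreover have "vdeg (verts C) ?a = 2 * (s - 1) + 1"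
    using C(4) s by (simp add: vdeg_sum)
  moreover have "Poly_Mapping.keys ?a \<subseteq> verts C"
    using keys_sum_nat[of unit_vec "verts C"] by auto
  ultimately show ?thesis using s by (simp add: critical_def del: edge_power.simps)
qed

text \<open>If \<open>v\<close> is already in the closed neighbourhood of \<open>W\<close>, the old
  extra edge and \<open>{u, w}\<close> suffice. Otherwise \<open>v\<close> is adjacent to
  \<open>w\<close>, and the factors are paired anew: \<open>u\<close> completes an edge with
  \<open>a\<close>, while \<open>w\<close> is matched with \<open>v\<close>.\<close>

lemma critical_insert:
  fixes G :: "'v::finite ugraph"
  assumes crit: "critical G W k a" and u: "u \<in> W" "{u, w} \<in> edges G" and w: "w \<in> verts G" "w \<notin> W"
  shows "critical G (insert w W) (Suc k) (a + (unit_vec u + unit_vec w))"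
proof -
  note c = crit[unfolded critical_def]
  let ?a = "a + (unit_vec u + unit_vec w)"
  have "vdeg (insert w W) a = vdeg W a"
    using c w by (auto simp: vdeg_def in_keys_iff)
  then have "vdeg (insert w W) ?a = 2 * Suc k + 1"
    using c u w by (simp add: vdeg_add)
  moreover have "Poly_Mapping.keys ?a \<subseteq> insert w W"
    using c u by (auto simp: keys_add_nat)
  moreover have "?a \<in> edge_power G (Suc k)"
    using edge_power_mult[OF _ edge_power_edge[OF u(2)], of a k] c by simp
  moreover have "?a + unit_vec v \<in> edge_power G (Suc (Suc k))" if v: "v \<in> closed_nbhd G (insert w W)" for v
  proof (cases "v \<in> closed_nbhd G W")
    case True
    then have "(a + unit_vec v) + (unit_vec u + unit_vec w) \<in> edge_power G (Suc k + 1)"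
      using c edge_power_edge[OF u(2)] by (intro edge_power_mult) auto
    then show ?thesis by (simp add: ac_simps del: edge_power.simps)
  next
    case False
    \<comment> \<open>This excludes \<open>v = w\<close>, so \<open>v\<close> can only be new as a
      neighbour of \<open>w\<close>.\<close>
    have "w \<in> closed_nbhd G W" using u w by (auto simp: closed_nbhd_def)
    with v False have "{w, v} \<in> edges G" by (auto simp: closed_nbhd_def)
    moreover have "u \<in> closed_nbhd G W" using u by (simp add: closed_nbhd_def)
    ultimately have "(a + unit_vec u) + (unit_vec w + unit_vec v) \<in> edge_power G (Suc k + 1)"
      using c edge_power_edge[of w v G] by (intro edge_power_mult) auto
    then show ?thesis by (simp add: ac_simps del: edge_power.simps)
  qed
  ultimately show ?thesis by (simp add: critical_def del: edge_power.simps)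
qed

text \<open>Connectedness of \<open>K\<close> enters as \<open>cross\<close>: as long as vertices
  are missing, some edge leads to one of them, and attaching it raises \<open>k\<close> by
  one.\<close>

lemma critical_extend:
  fixes G :: "'v::finite ugraph"
  assumes "critical G W k a" "W \<noteq> {}" "W \<subseteq> K" "K \<subseteq> verts G"
    and cross: "\<And>S. S \<noteq> {} \<Longrightarrow> S \<subset> K \<Longrightarrow> \<exists>u\<in>S. \<exists>w\<in>K - S. {u, w} \<in> edges G"
  shows "\<exists>b. critical G K (k + card (K - W)) b"
  using assms(1-3)
proof (induction "card (K - W)" arbitrary: W k a)
  case 0
  then show ?case by (metis add.right_neutral card_0_eq Diff_eq_empty_iff finite subset_antisym)
next
  case (Suc n)
  then have "W \<subset> K" by (metis Diff_cancel card.empty nat.distinct(1) psubsetI)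
  then obtain u w where uw: "u \<in> W" "w \<in> K - W" "{u, w} \<in> edges G"
    using cross Suc.prems(2) by metis
  have card: "card (K - W) = Suc (card (K - insert w W))"
    using uw(2) by (metis Diff_insert card_Suc_Diff1 finite)
  have "\<exists>b. critical G K (Suc k + card (K - insert w W)) b"
  proof (rule Suc.hyps(1))
    show "critical G (insert w W) (Suc k) (a + (unit_vec u + unit_vec w))"
      using Suc.prems uw assms(4) by (intro critical_insert) auto
    show "n = card (K - insert w W)" using Suc.hyps(2) card by simp
    show "insert w W \<subseteq> K" using Suc.prems(3) uw(2) by blast
  qed simp
  then show ?case using card by simp
qed

section \<open>Degree bounds for products of edges\<close>

text \<open>Each edge dividing a monomial supported in \<open>D\<close> has both ends in some
  \<open>W i\<close>. Splitting it off lowers the degree on that \<open>W i\<close> by two, hence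
  its rounded half by one.\<close>

lemma edge_power_le_half_degrees:
  fixes G :: "'v::finite ugraph"
  assumes "finite A" and E: "\<And>x y. {x, y} \<in> edges G \<Longrightarrow> x \<in> D \<Longrightarrow> y \<in> D \<Longrightarrow> \<exists>i\<in>A. x \<in> W i \<and> y \<in> W i"
    and "a \<in> edge_power G t" "Poly_Mapping.keys a \<subseteq> D"
  shows "t \<le> (\<Sum>i\<in>A. vdeg (W i) a div 2)"
  using assms(3,4)
proof (induction t arbitrary: a)
  case (Suc t)
  then obtain c x y where c: "c \<in> edge_power G t" "{x, y} \<in> edges G" "a = c + (unit_vec x + unit_vec y)"
    by auto
  then have xy: "x \<in> D" "y \<in> D" "Poly_Mapping.keys c \<subseteq> D" using Suc.prems(2) by (auto simp: keys_add_nat)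
  then obtain i where i: "i \<in> A" "x \<in> W i" "y \<in> W i" using E c(2) by blast
  have "t \<le> (\<Sum>i\<in>A. vdeg (W i) c div 2)" using Suc.IH c(1) xy(3) by blast
  also have "\<dots> < (\<Sum>i\<in>A. vdeg (W i) a div 2)"
  proof (rule sum_strict_mono_ex1)
    show "\<forall>i\<in>A. vdeg (W i) c div 2 \<le> vdeg (W i) a div 2"
      by (simp add: c(3) vdeg_add div_le_mono)
    show "\<exists>i\<in>A. vdeg (W i) c div 2 < vdeg (W i) a div 2"
      using i by (intro bexI[of _ i]) (simp_all add: c(3) vdeg_add)
  qed (rule assms(1))
  finally show ?case by simp
qed simp

text \<open>Every edge factor contributes at least one variable from the cover.\<close>

lemma edge_power_le_cover_degree:
  fixes G :: "'v::finite ugraph"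
  assumes "is_cover G F" "a \<in> edge_power G t"
  shows "t \<le> vdeg F a"
  using assms(2)
proof (induction t arbitrary: a)
  case (Suc t)
  then obtain c x y where c: "c \<in> edge_power G t" "{x, y} \<in> edges G" "a = c + (unit_vec x + unit_vec y)"
    by auto
  have "x \<in> F \<or> y \<in> F" using assms(1) c(2) by (auto simp: is_cover_def)
  then show ?case using Suc.IH[OF c(1)] by (auto simp: c(3) vdeg_add)
qed simp

section \<open>Associated primes from covers\<close>

text \<open>The product of all variables outside \<open>F\<close> contains the partner
  \<open>w\<close> that \<open>v\<close> needs.\<close>

lemma edge_power_outside:
  fixes G :: "'v::finite ugraph"
  assumes "{v, w} \<in> edges G" "w \<notin> F"
  shows "unit_vec v + (\<Sum>x\<in>-F. unit_vec x) \<in> edge_power G 1"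
proof -
  have "(\<Sum>x\<in>-F. unit_vec x) = unit_vec w + (\<Sum>x\<in>-F - {w}. unit_vec x)"
    using assms(2) by (simp add: sum.remove)
  then have "unit_vec v + (\<Sum>x\<in>-F. unit_vec x) = (unit_vec v + unit_vec w) + (\<Sum>x\<in>-F - {w}. unit_vec x)"
    by (simp add: ac_simps)
  then show ?thesis using edge_power_add[OF edge_power_edge[OF assms(1)]] by metis
qed

lemma vdeg_outside: "S \<subseteq> F \<Longrightarrow> vdeg S (\<Sum>x\<in>-F. unit_vec x) = 0"
  using keys_sum_nat[of unit_vec "-F"] by (intro vdeg_eq_0) auto

text \<open>An edge missed by \<open>F - {v}\<close> meets \<open>F\<close> only in
  \<open>v\<close>, so its other end lies outside \<open>F\<close>.\<close>

lemma irredundant_cover_outside_neighbour: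
  assumes "simple_graph G" "is_cover G F" "\<not> is_cover G (F - {v})"
  obtains w where "{v, w} \<in> edges G" "w \<notin> F"
proof -
  obtain e where e: "e \<in> edges G" "e \<inter> (F - {v}) = {}" "e \<inter> F \<noteq> {}"
    using assms by (auto simp: is_cover_def)
  then have "v \<in> e" "card e = 2" using assms(1) by (auto simp: simple_graph_def)
  then obtain w where "e = {v, w}" "w \<noteq> v" by (auto simp: card_2_iff)
  with e that show thesis by blast
qed

text \<open>With \<open>?g\<close> the product of the variables outside \<open>F\<close>, the
  witness is \<open>n\<close> copies of \<open>x_v0 * ?g\<close> times one more \<open>?g\<close>.
  Each copy contains an edge and the spare \<open>?g\<close> completes one with any \<open>v\<close>
  in \<open>F\<close>, but the degree on \<open>F\<close> is only \<open>n\<close>.\<close>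

lemma associated_prime_minimal_cover:
  fixes G :: "'v::finite ugraph"
  assumes G: "simple_graph G" and F: "is_cover G F" "\<And>v. v \<in> F \<Longrightarrow> \<not> is_cover G (F - {v})" "F \<noteq> {}"
  shows "var_ideal F \<in> associated_primes (mpoly_ring :: ('v, 'k::field) mpoly ring)
    (ideal_power mpoly_ring (edge_ideal G) (Suc n))"
proof -
  obtain v0 where v0: "v0 \<in> F" using F(3) by blast
  let ?g = "\<Sum>x\<in>-F. unit_vec x"
  have out: "unit_vec v + ?g \<in> edge_power G 1" if "v \<in> F" for v
    using irredundant_cover_outside_neighbour[OF G F(1) F(2)[OF that]] edge_power_outside by metis
  define a where "a = (\<Sum>i<n. unit_vec v0 + ?g) + ?g"
  show ?thesis
  proof (rule var_ideal_associated_primeI)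
    fix v assume "v \<in> F"
    then have "(\<Sum>i<n. unit_vec v0 + ?g) + (unit_vec v + ?g) \<in> edge_power G ((\<Sum>i<n. 1) + 1)"
      using out v0 by (intro edge_power_mult edge_power_sum) auto
    then show "a + unit_vec v \<in> edge_power G (Suc n)"
      by (simp add: a_def ac_simps del: edge_power.simps)
  next
    fix b :: "'v \<Rightarrow>\<^sub>0 nat" assume "Poly_Mapping.keys b \<inter> F = {}"
    then have "vdeg F (a + b) = n"
      using v0 by (simp add: a_def vdeg_add vdeg_sum vdeg_outside vdeg_eq_0 del: sum_constant) simp
    then show "a + b \<notin> edge_power G (Suc n)"
      using edge_power_le_cover_degree[OF F(1), of "a + b" "Suc n"] by auto
  qed
qed

text \<open>The critical monomials respond to variables of the closed neighbourhood of
  \<open>U\<close>, the factor \<open>?g\<close> to the rest of \<open>F\<close>. The factor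
  \<open>?e\<close>, a power of one edge inside \<open>W i0\<close>, raises the exponent by
  \<open>d\<close> and preserves the parity of all degrees on the sets \<open>W i\<close>.\<close>

lemma associated_prime_critical:
  fixes G :: "'v::finite ugraph"
  assumes G: "simple_graph G" "verts G = UNIV" and "finite A" and disj: "disjoint_family_on W A"
    and U: "(\<Union>i\<in>A. W i) = U"
    and crit: "\<And>i. i \<in> A \<Longrightarrow> critical G (W i) (k i) (f i)"
    and sep: "\<And>i x y. i \<in> A \<Longrightarrow> {x, y} \<in> edges G \<Longrightarrow> x \<in> W i \<Longrightarrow> y \<in> U \<Longrightarrow> y \<in> W i"
    and pq: "i0 \<in> A" "p \<in> W i0" "q \<in> W i0" "{p, q} \<in> edges G"
    and F: "minimal_cover_containing G (closed_nbhd G U) F"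
  shows "var_ideal F \<in> associated_primes (mpoly_ring :: ('v, 'k::field) mpoly ring)
    (ideal_power mpoly_ring (edge_ideal G) ((\<Sum>i\<in>A. k i) + d + 1))"
proof -
  let ?g = "\<Sum>x\<in>-F. unit_vec x" and ?e = "\<Sum>i<d. unit_vec p + unit_vec q"
  have cover: "is_cover G F" and NF: "closed_nbhd G U \<subseteq> F"
    using F by (auto simp: minimal_cover_containing_def)
  have UF: "U \<subseteq> F" using NF by (auto simp: closed_nbhd_def)
  have e: "?e \<in> edge_power G (\<Sum>i<d. 1)"
    using edge_power_edge[OF pq(4)] by (intro edge_power_sum) auto
  have fk: "f i \<in> edge_power G (k i)" if "i \<in> A" for i
    using crit[OF that] by (simp add: critical_def)
  define a where "a = (\<Sum>i\<in>A. f i) + ?e + ?g"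
  show ?thesis
  proof (rule var_ideal_associated_primeI)
    fix v assume v: "v \<in> F"
    show "a + unit_vec v \<in> edge_power G ((\<Sum>i\<in>A. k i) + d + 1)"
    proof (cases "v \<in> closed_nbhd G U")
      case True
      then obtain i where i: "i \<in> A" "v \<in> closed_nbhd G (W i)"
        by (auto simp: closed_nbhd_def U[symmetric])
      have "f i + unit_vec v \<in> edge_power G (Suc (k i))"
        using crit[OF i(1)] i(2) by (simp add: critical_def del: edge_power.simps)
      then have "(f i + unit_vec v) + (\<Sum>i\<in>A - {i}. f i) + ?e + ?g
          \<in> edge_power G (Suc (k i) + (\<Sum>i\<in>A - {i}. k i) + (\<Sum>i<d. 1))"
        using fk by (intro edge_power_add[OF edge_power_mult[OF edge_power_mult e]] edge_power_sum) simp_all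
      moreover have "(\<Sum>i\<in>A. f i) = f i + (\<Sum>i\<in>A - {i}. f i)" "(\<Sum>i\<in>A. k i) = k i + (\<Sum>i\<in>A - {i}. k i)"
        using i(1) assms(3) by (simp_all add: sum.remove)
      ultimately show ?thesis by (simp add: a_def ac_simps del: edge_power.simps)
    next
      case False
      \<comment> \<open>Since \<open>v\<close> is outside the closed neighbourhood of
        \<open>U\<close>, the set \<open>F - {v}\<close> still contains it, and minimality of
        \<open>F\<close> applies.\<close>
      have "\<not> is_cover G (F - {v})"
        using F v False unfolding minimal_cover_containing_def by blast
      then obtain w where "{v, w} \<in> edges G" "w \<notin> F"
        by (rule irredundant_cover_outside_neighbour[OF G(1) cover])
      then have "unit_vec v + ?g \<in> edge_power G 1" by (rule edge_power_outside)
      then have "(\<Sum>i\<in>A. f i) + ?e + (unit_vec v + ?g) \<in> edge_power G ((\<Sum>i\<in>A. k i) + (\<Sum>i<d. 1) + 1)"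
        using fk by (intro edge_power_mult[OF edge_power_mult[OF edge_power_sum e]]) simp_all
      then show ?thesis by (simp add: a_def ac_simps del: edge_power.simps)
    qed
  next
    fix b :: "'v \<Rightarrow>\<^sub>0 nat" assume b: "Poly_Mapping.keys b \<inter> F = {}"
    \<comment> \<open>Neither \<open>?g\<close> nor \<open>b\<close> involves variables of
      \<open>F\<close>, so only \<open>f i\<close> and, for \<open>i = i0\<close>, the factor
      \<open>?e\<close> contribute. The odd unit is lost on halving.\<close>
    have deg: "vdeg (W i) (a + b) = 2 * (k i + (if i = i0 then d else 0)) + 1" if i: "i \<in> A" for i
    proof -
      have WF: "W i \<subseteq> F" using i U UF by blast
      have "vdeg (W i) (f j) = (if j = i then 2 * k i + 1 else 0)" if "j \<in> A" for j
      proof (cases "j = i")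
        case True
        with crit[OF i] show ?thesis by (simp add: critical_def)
      next
        case False
        then have "W j \<inter> W i = {}" using disj i that by (auto simp: disjoint_family_on_def)
        then have "Poly_Mapping.keys (f j) \<inter> W i = {}" using crit[OF that] by (auto simp: critical_def)
        with False show ?thesis by (simp add: vdeg_eq_0)
      qed
      then have "vdeg (W i) (\<Sum>j\<in>A. f j) = 2 * k i + 1"
        using i assms(3) by (simp add: vdeg_sum)
      moreover have "p \<in> W i \<longleftrightarrow> i = i0" "q \<in> W i \<longleftrightarrow> i = i0"
        using pq disj i by (auto simp: disjoint_family_on_def)
      then have "vdeg (W i) ?e = (if i = i0 then 2 * d else 0)"
        by (simp add: vdeg_sum vdeg_add)
      moreover have "vdeg (W i) b = 0" using b WF by (intro vdeg_eq_0) auto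
      ultimately show ?thesis using WF by (simp add: a_def vdeg_add vdeg_outside)
    qed
    have keys: "Poly_Mapping.keys (a + b) \<subseteq> U \<union> - F"
    proof -
      have "Poly_Mapping.keys (\<Sum>i\<in>A. f i) \<subseteq> U"
        using keys_sum_nat[of f A] crit U unfolding critical_def by blast
      moreover have "Poly_Mapping.keys ?e \<subseteq> U"
      proof
        fix x assume x: "x \<in> Poly_Mapping.keys ?e"
        have "x \<in> (\<Union>i<d. Poly_Mapping.keys (unit_vec p + unit_vec q))"
          by (rule subsetD[OF keys_sum_nat x])
        then have "x \<in> Poly_Mapping.keys (unit_vec p + unit_vec q)" by blast
        then have "x = p \<or> x = q" by (auto simp: keys_add_nat)
        then show "x \<in> U" using pq(1-3) U by blast
      qed
      moreover have "Poly_Mapping.keys ?g \<subseteq> - F"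
        using keys_sum_nat[of unit_vec "-F"] by auto
      moreover have "Poly_Mapping.keys b \<subseteq> - F" using b by blast
      ultimately show ?thesis unfolding a_def keys_add_nat by (intro Un_least) (simp_all add: le_supI1 le_supI2)
    qed
    \<comment> \<open>The cover \<open>F\<close> forces one end into \<open>U\<close>. The other end
      is then in the closed neighbourhood of \<open>U\<close>, hence in \<open>F\<close>, hence also
      in \<open>U\<close>, and \<open>sep\<close> puts both into the same
      \<open>W i\<close>.\<close>
    have E: "\<exists>i\<in>A. x \<in> W i \<and> y \<in> W i"
      if xy: "{x, y} \<in> edges G" "x \<in> U \<union> - F" "y \<in> U \<union> - F" for x y
    proof -
      have "x \<in> F \<or> y \<in> F" using cover xy(1) by (auto simp: is_cover_def)
      then have "x \<in> U \<or> y \<in> U" using xy by blast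
      moreover have "{y, x} \<in> edges G" using xy(1) by (simp only: insert_commute)
      ultimately have "x \<in> closed_nbhd G U \<and> y \<in> closed_nbhd G U"
        using xy(1) G(2) unfolding closed_nbhd_def by blast
      then have "x \<in> F \<and> y \<in> F" using NF by blast
      then have "x \<in> U" "y \<in> U" using xy by auto
      then show ?thesis using sep xy(1) U by blast
    qed
    show "a + b \<notin> edge_power G ((\<Sum>i\<in>A. k i) + d + 1)"
    proof
      assume mem: "a + b \<in> edge_power G ((\<Sum>i\<in>A. k i) + d + 1)"
      have "(\<Sum>i\<in>A. k i) + d + 1 \<le> (\<Sum>i\<in>A. vdeg (W i) (a + b) div 2)"
        by (rule edge_power_le_half_degrees[OF assms(3) _ mem keys]) (rule E)
      also have "\<dots> = (\<Sum>i\<in>A. k i + (if i = i0 then d else 0))"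
        by (intro sum.cong) (simp_all add: deg)
      also have "\<dots> = (\<Sum>i\<in>A. k i) + d"
        using assms(3) pq(1) by (simp add: sum.distrib)
      finally show False by simp
    qed
  qed
qed

section \<open>Odd cycles\<close>

lemma matching_number_ge:
  fixes G :: "'v::finite ugraph"
  assumes "is_matching G M"
  shows "card M \<le> \<nu> G"
  using assms unfolding matching_number_def by (intro Max_ge) auto

lemma two_matching_number_le:
  fixes G :: "'v::finite ugraph"
  assumes "simple_graph G"
  shows "2 * \<nu> G \<le> card (verts G)"
proof -
  have "card ` {M. is_matching G M} \<noteq> {}"
    by (auto simp: is_matching_def intro!: exI[of _ "{}"])
  then have "\<nu> G \<in> card ` {M. is_matching G M}"
    unfolding matching_number_def by (intro Max_in) auto
  then obtain M where M: "M \<subseteq> edges G" "disjoint M" "\<nu> G = card M"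
    by (auto simp: is_matching_def)
  have "card (\<Union>M) = 2 * card M"
    using M assms by (intro card_Union_matching) (auto simp: simple_graph_def)
  moreover have "card (\<Union>M) \<le> card (verts G)"
    using M assms by (intro card_mono) (auto simp: simple_graph_def)
  ultimately show ?thesis using M by simp
qed

text \<open>Deleting a vertex from a cycle on \<open>2 * s - 1\<close> vertices leaves a path whose
  alternate edges form a perfect matching; \<open>s\<close> disjoint edges would need one vertex
  more than the cycle has.\<close>

lemma contains_saturating_odd_cycle:
  fixes H :: "'v::finite ugraph"
  assumes H: "simple_graph H" and xs: "is_cycle H xs" "odd (length xs)"
  shows "contains_saturating H ((length xs + 1) div 2)"
proof -
  define n where "n = length xs"
  define s where "s = (n + 1) div 2"
  have n: "n = 2 * s - 1" "s \<ge> 2" "n \<ge> 3" "n = length xs"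
    using xs by (auto simp: n_def s_def is_cycle_def elim!: oddE)
  have dist: "distinct xs" using xs by (simp add: is_cycle_def)
  define E where "E = (\<lambda>i. {xs ! i, xs ! (Suc i mod n)}) ` {..<n}"
  define C where "C = \<lparr>verts = set xs, edges = E\<rparr>"
  have EH: "E \<subseteq> edges H" using xs n(4) by (auto simp: E_def is_cycle_def)
  have EX: "e \<subseteq> set xs" if e: "e \<in> E" for e
  proof -
    obtain i where i: "i < n" "e = {xs ! i, xs ! (Suc i mod n)}" using e by (auto simp: E_def)
    then have "Suc i mod n < n" by simp
    with i n(4) show ?thesis by simp
  qed
  have "set xs \<subseteq> verts H"
  proof
    fix v assume "v \<in> set xs"
    then obtain i where "i < n" "v = xs ! i" using n(4) by (auto simp: in_set_conv_nth)
    then have "v \<in> \<Union>E" by (auto simp: E_def)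
    then show "v \<in> verts H" using EH H by (auto simp: simple_graph_def)
  qed
  moreover have "simple_graph C"
    using EH EX H by (auto simp: C_def simple_graph_def)
  ultimately have C: "simple_graph C" "verts C \<subseteq> verts H" "edges C \<subseteq> edges H" "card (verts C) = 2 * s - 1"
    using EH dist n(1,4) by (simp_all add: C_def distinct_card)
  have "s - 1 \<le> \<nu> (delete_vertex C j)" if j: "j \<in> set xs" for j
  proof -
    obtain p where p: "p < n" "xs ! p = j" using j n by (auto simp: in_set_conv_nth)
    \<comment> \<open>The cycle is renumbered to start at \<open>j = y 0\<close>, so that the edges
      \<open>{y 1, y 2}\<close>, \<open>{y 3, y 4}\<close>, ... avoid \<open>j\<close>.\<close>
    define y where "y = (\<lambda>i. xs ! ((p + i) mod n))"
    have y_inj: "y a = y b \<longleftrightarrow> a = b" if "a < n" "b < n" for a b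
    proof -
      have "y i = rotate p xs ! i" if "i < n" for i
        using that n(4) by (simp add: y_def nth_rotate)
      then show ?thesis using that dist n(4) by (simp add: nth_eq_iff_index_eq)
    qed
    have y0: "y 0 = j" using p by (simp add: y_def)
    have yE: "{y i, y (Suc i)} \<in> E" for i
      unfolding E_def y_def using n
      by (intro image_eqI[of _ _ "(p + i) mod n"]) (auto simp: mod_Suc_eq)
    define e where "e = (\<lambda>k. {y (2 * k + 1), y (2 * k + 2)})"
    define M where "M = e ` {..<s - 1}"
    have e_disj: "e k \<inter> e l = {}" if "k < s - 1" "l < s - 1" "k \<noteq> l" for k l
    proof -
      \<comment> \<open>The largest index in use is \<open>2 * s - 2 = n - 1\<close>, so the
        numbering does not wrap around.\<close>
      have "2 * k + 2 < n" "2 * l + 2 < n" using that n by auto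
      then show ?thesis using that(3) by (auto simp: e_def y_inj)
    qed
    have "inj_on e {..<s - 1}"
    proof (rule inj_onI, rule ccontr)
      fix k l assume "k \<in> {..<s - 1}" "l \<in> {..<s - 1}" "e k = e l" "k \<noteq> l"
      then show False using e_disj[of k l] by (auto simp: e_def)
    qed
    then have "card M = s - 1" by (simp add: M_def card_image)
    moreover have "is_matching (delete_vertex C j) M"
    proof -
      have "j \<notin> e k" if "k < s - 1" for k
      proof -
        have "2 * k + 2 < n" using that n by auto
        then show ?thesis by (auto simp: e_def y_inj simp flip: y0)
      qed
      moreover have "e k \<in> E" for k using yE[of "2 * k + 1"] by (simp add: e_def)
      moreover have "disjoint M"
        using e_disj by (auto simp: M_def disjoint_def)
      ultimately show ?thesis
        using EX by (auto simp: is_matching_def delete_vertex_def induced_def C_def M_def)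
    qed
    ultimately show ?thesis using matching_number_ge by metis
  qed
  moreover have "\<nu> C < s" using two_matching_number_le[OF C(1)] C(4) n(2) by linarith
  ultimately have "strongly_saturating s C" by (simp add: strongly_saturating_def C_def)
  then show ?thesis
    using C unfolding contains_saturating_def subgraph_of_def s_def n_def by blast
qed

section \<open>Connected components\<close>

lemma equiv_connectedness:
  "equiv (verts G) (connectedness G)"
proof -
  have "sym {(u, v). {u, v} \<in> edges G}" by (auto simp: sym_def insert_commute)
  then have s: "sym ({(u, v). {u, v} \<in> edges G}\<^sup>*)" by (rule sym_rtrancl)
  show ?thesis
  proof (rule equivI)
    show "sym (connectedness G)"
      using s by (auto simp: connectedness_def sym_def)
    show "trans (connectedness G)"
      by (auto simp: connectedness_def trans_def)
  qed (auto simp: connectedness_def refl_on_def)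
qed

lemma component_edge_closed:
  assumes "simple_graph G" "K \<in> verts G // connectedness G" "{x, y} \<in> edges G" "x \<in> K"
  shows "y \<in> K"
proof -
  have "(x, y) \<in> connectedness G"
    using assms by (auto simp: connectedness_def simple_graph_def)
  then show ?thesis
    using assms(2,4) equiv_connectedness[of G]
    by (metis in_quotient_imp_closed)
qed

text \<open>A walk from a vertex of \<open>S\<close> to one of \<open>K - S\<close> stays in
  \<open>K\<close>; without a crossing edge, induction along the walk would keep it in
  \<open>S\<close>.\<close>

lemma component_crossing_edge:
  assumes K: "K \<in> verts G // connectedness G" and S: "S \<noteq> {}" "S \<subset> K"
    and G: "simple_graph G"
  shows "\<exists>u\<in>S. \<exists>w\<in>K - S. {u, w} \<in> edges G"
proof (rule ccontr)
  assume neg: "\<not> ?thesis"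
  obtain x y where xy: "x \<in> S" "y \<in> K" "y \<notin> S" using S by blast
  then have "(x, y) \<in> connectedness G"
    using K S(2) equiv_connectedness[of G] by (metis psubsetD quotient_eq_iff)
  then have "(x, y) \<in> {(u, v). {u, v} \<in> edges G}\<^sup>*" by (simp add: connectedness_def)
  then have "y \<in> S"
  proof induction
    case (step y z)
    then have "z \<in> K" using component_edge_closed[OF G K] S(2) by blast
    then show ?case using neg step by blast
  qed (rule xy(1))
  with xy show False by simp
qed

section \<open>The embedded prime\<close>

lemma exists_irredundant_cover:
  fixes G :: "'v::finite ugraph"
  assumes "is_cover G F"
  shows "\<exists>F'\<subseteq>F. is_cover G F' \<and> (\<forall>v\<in>F'. \<not> is_cover G (F' - {v}))"
proof -
  let ?S = "{F'. is_cover G F' \<and> F' \<subseteq> F}"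
  have "\<exists>F'\<in>?S. \<forall>F''\<in>?S. F'' \<subseteq> F' \<longrightarrow> F' = F''"
    using assms by (intro finite_has_minimal) auto
  then obtain F' where F': "is_cover G F'" "F' \<subseteq> F"
      "\<And>F''. is_cover G F'' \<Longrightarrow> F'' \<subseteq> F \<Longrightarrow> F'' \<subseteq> F' \<Longrightarrow> F' = F''"
    by auto
  have "\<not> is_cover G (F' - {v})" if "v \<in> F'" for v
    using F'(2) F'(3)[of "F' - {v}"] that by blast
  with F'(1,2) show ?thesis by blast
qed

lemma var_ideal_psubset:
  assumes "F' \<subset> F"
  shows "(var_ideal F' :: ('v, 'k::field) mpoly set) \<subset> var_ideal F"
proof -
  obtain v where v: "v \<in> F" "v \<notin> F'" using assms by blast
  have "(Poly_Mapping.single (unit_vec v) 1 :: ('v, 'k) mpoly) \<in> var_ideal F - var_ideal F'"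
    using v by (auto simp: var_ideal_eq monomial_ideal_def)
  moreover have "(var_ideal F' :: ('v, 'k) mpoly set) \<subseteq> var_ideal F"
    using assms by (auto simp: var_ideal_eq monomial_ideal_def)
  ultimately show ?thesis by blast
qed

text \<open>An edge at \<open>u\<close> is still covered by its other end, a neighbour of
  \<open>u\<close> and so in \<open>F\<close>.\<close>

lemma cover_remove:
  assumes "simple_graph G" "is_cover G F" "closed_nbhd G {u} \<subseteq> F"
  shows "is_cover G (F - {u})"
proof -
  have "e \<inter> (F - {u}) \<noteq> {}" if e: "e \<in> edges G" for e
  proof (cases "u \<in> e")
    case True
    then obtain w where w: "e = {u, w}" "u \<noteq> w" "e \<subseteq> verts G"
      using assms(1) e by (auto simp: simple_graph_def card_2_iff doubleton_eq_iff)
    then have "w \<in> F" using assms(3) e by (auto simp: closed_nbhd_def)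
    then show ?thesis using w by auto
  next
    case False
    then show ?thesis using assms(2) e by (auto simp: is_cover_def)
  qed
  then show ?thesis using assms(2) by (auto simp: is_cover_def)
qed

theorem theorem3p5:
  fixes \<Gamma> :: "'v::finite ugraph"
    and I :: "('v, 'k::field) mpoly set"
    and U F :: "'v set"
    and m :: nat
    and comp :: "nat \<Rightarrow> 'v ugraph"
    and s :: "nat \<Rightarrow> nat"
    and t :: nat
  assumes "simple_graph \<Gamma>"
    and "verts \<Gamma> = UNIV"
    and "I = edge_ideal \<Gamma>"
    and "U \<noteq> {}"
    and "\<forall>H\<in>components (induced \<Gamma> U). has_odd_cycle H"
    and "minimal_cover_containing \<Gamma> (closed_nbhd \<Gamma> U) F"
    and "bij_betw comp {1..m} (components (induced \<Gamma> U))"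
    and "\<forall>i\<in>{1..m}. contains_saturating (comp i) (s i) \<and>
           (\<forall>s'. contains_saturating (comp i) s' \<longrightarrow> s' \<le> s i)"
    and "int t \<ge> int (card U) - (\<Sum>i=1..m. int (s i)) + 1"
  shows "embedded_associated_prime mpoly_ring (ideal_power mpoly_ring I t) (var_ideal F)"
proof -
  define G where "G = induced \<Gamma> U"
  define Q where "Q = verts G // connectedness G"
  define W where "W = (\<lambda>i. verts (comp i))"
  have G: "simple_graph G" "verts G = U" "edges G = {e \<in> edges \<Gamma>. e \<subseteq> U}"
    using assms(1) by (auto simp: G_def induced_def simple_graph_def finite_subset)
  have equiv: "equiv U (connectedness G)" using equiv_connectedness[of G] G(2) by simp
  have image: "comp ` {1..m} = induced G ` Q"
    using assms(7) by (simp add: bij_betw_def components_def G_def Q_def)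
  have compW: "comp i = induced G (W i)" and WQ: "W i \<in> Q" if i: "i \<in> {1..m}" for i
  proof -
    obtain K where "K \<in> Q" "comp i = induced G K" using i image by blast
    then show "comp i = induced G (W i)" "W i \<in> Q" by (simp_all add: W_def induced_def)
  qed
  have compE: "edges (comp i) = {e \<in> edges \<Gamma>. e \<subseteq> U \<and> e \<subseteq> W i}" if "i \<in> {1..m}" for i
    using arg_cong[OF compW[OF that], of edges] G(3) by (simp add: induced_def conj_assoc)
  have WimQ: "W ` {1..m} = Q"
  proof -
    have "W ` {1..m} = verts ` induced G ` Q" unfolding W_def image[symmetric] image_image ..
    then show ?thesis by (simp add: image_image induced_def)
  qed
  have Union: "(\<Union>i\<in>{1..m}. W i) = U"
    using Union_quotient[OF equiv] WimQ by (simp add: Q_def G(2))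
  have disj: "disjoint_family_on W {1..m}"
    unfolding disjoint_family_on_def
  proof (intro ballI impI)
    fix i j assume ij: "i \<in> {1..m}" "j \<in> {1..m}" "i \<noteq> j"
    \<comment> \<open>By \<open>compW\<close> the vertex set determines the component, so
      injectivity of \<open>comp\<close> passes to \<open>W\<close>.\<close>
    then have "W i \<noteq> W j"
      using compW assms(7) by (metis bij_betw_def inj_onD)
    then show "W i \<inter> W j = {}"
      using quotient_disj[OF equiv] WQ ij by (metis Q_def G(2))
  qed
  have simple: "simple_graph (comp i)" if "i \<in> {1..m}" for i
    using compW[OF that] G(1) by (simp add: induced_def simple_graph_def)
  \<comment> \<open>The odd cycle has length at least 3, hence yields a saturating subgraph with
    parameter at least 2, and \<open>s i\<close> is maximal.\<close>
  have s2: "2 \<le> s i" if i: "i \<in> {1..m}" for i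
  proof -
    have "has_odd_cycle (comp i)"
      using assms(5,7) i by (auto simp: bij_betw_def)
    then obtain xs where xs: "is_cycle (comp i) xs" "odd (length xs)" by (auto simp: has_odd_cycle_def)
    have "(length xs + 1) div 2 \<le> s i"
      using contains_saturating_odd_cycle[OF simple[OF i] xs] assms(8) i by blast
    moreover have "length xs \<ge> 3" using xs by (simp add: is_cycle_def)
    ultimately show ?thesis by linarith
  qed
  \<comment> \<open>The parameter starts at \<open>s i - 1\<close> on \<open>2 * s i - 1\<close>
    vertices and grows by one for each remaining vertex, which gives
    \<open>card (W i) - s i\<close>. The bound \<open>s i \<le> card (W i)\<close> is kept so that
    this difference agrees with the integer one.\<close>
  have crit: "s i \<le> card (W i) \<and> (\<exists>a. critical \<Gamma> (W i) (card (W i) - s i) a)" if i: "i \<in> {1..m}" for i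
  proof -
    have "contains_saturating (comp i) (s i)" using assms(8) i by blast
    then obtain C where C: "subgraph_of C (comp i)" "strongly_saturating (s i) C" "card (verts C) = 2 * s i - 1"
      unfolding contains_saturating_def by blast
    have sub: "verts C \<subseteq> W i" "edges C \<subseteq> edges \<Gamma>" "simple_graph C"
      using C(1) compE[OF i] by (auto simp: subgraph_of_def W_def)
    have "verts C \<noteq> {}" using C(3) s2[OF i] by auto
    have "critical \<Gamma> (verts C) (s i - 1) (\<Sum>v\<in>verts C. unit_vec v)"
      by (rule critical_saturating[OF sub(3,2) C(2,3) s2[OF i]])
    then have "\<exists>a. critical \<Gamma> (W i) (s i - 1 + card (W i - verts C)) a"
      using \<open>verts C \<noteq> {}\<close> sub(1)
    proof (rule critical_extend)
      fix S assume "S \<noteq> {}" "S \<subset> W i"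
      then have "\<exists>u\<in>S. \<exists>w\<in>W i - S. {u, w} \<in> edges G"
        using WQ[OF i] G(1) unfolding Q_def by (intro component_crossing_edge)
      then show "\<exists>u\<in>S. \<exists>w\<in>W i - S. {u, w} \<in> edges \<Gamma>" using G(3) by blast
    qed (simp add: assms(2))
    moreover have "card (W i - verts C) = card (W i) - (2 * s i - 1)" "2 * s i - 1 \<le> card (W i)"
      using sub(1) C(3) by (simp_all add: card_Diff_subset) (metis card_mono finite)
    then have "s i - 1 + card (W i - verts C) = card (W i) - s i" "s i \<le> card (W i)"
      using s2[OF i] by linarith+
    ultimately show ?thesis by simp
  qed
  then have "\<forall>i\<in>{1..m}. \<exists>a. critical \<Gamma> (W i) (card (W i) - s i) a" by blast
  then obtain f where f: "\<forall>i\<in>{1..m}. critical \<Gamma> (W i) (card (W i) - s i) (f i)" by (rule bchoice[THEN exE])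
  define k where "k = (\<lambda>i. card (W i) - s i)"
  have "card U = (\<Sum>i\<in>{1..m}. card (W i))"
    unfolding Union[symmetric] using disj by (intro card_UN_disjoint) (auto simp: disjoint_family_on_def)
  then have "int (card U) - (\<Sum>i=1..m. int (s i)) = (\<Sum>i=1..m. int (card (W i)) - int (s i))"
    by (simp add: sum_subtractf)
  also have "\<dots> = (\<Sum>i=1..m. int (k i))"
    using crit by (intro sum.cong) (simp_all add: k_def of_nat_diff)
  finally have "int (\<Sum>i=1..m. k i) + 1 \<le> int t" using assms(9) by simp
  then have "(\<Sum>i=1..m. k i) + 1 \<le> t" by linarith
  \<comment> \<open>The surplus \<open>d\<close> of \<open>t\<close> over the least admissible
    exponent becomes the exponent of the edge \<open>{p, q}\<close>.\<close>
  then obtain d where t: "t = (\<Sum>i=1..m. k i) + d + 1"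
    by (metis add.assoc add.commute le_Suc_ex)
  \<comment> \<open>Since \<open>U\<close> is non-empty there is a component, and its odd cycle
    supplies the edge \<open>{p, q}\<close>. The vertex \<open>u\<close> is later removed from
    \<open>F\<close>.\<close>
  obtain u where u: "u \<in> U" using assms(4) by blast
  then obtain i0 where i0: "i0 \<in> {1..m}" using Union by blast
  have "has_odd_cycle (comp i0)" using assms(5,7) i0 by (auto simp: bij_betw_def)
  then obtain xs where xs: "is_cycle (comp i0) xs" by (auto simp: has_odd_cycle_def)
  then have "0 < length xs" by (auto simp: is_cycle_def)
  with xs have pq: "{xs ! 0, xs ! (Suc 0 mod length xs)} \<in> edges (comp i0)"
    unfolding is_cycle_def by blast
  define p q where "p = xs ! 0" and "q = xs ! (Suc 0 mod length xs)"
  have pq: "p \<in> W i0" "q \<in> W i0" "{p, q} \<in> edges \<Gamma>"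
    using pq unfolding compE[OF i0] p_def q_def by auto
  have P: "var_ideal F \<in> associated_primes (mpoly_ring :: ('v, 'k) mpoly ring) (ideal_power mpoly_ring I t)"
    unfolding assms(3) t
  proof (rule associated_prime_critical[OF assms(1,2) _ disj Union _ _ i0 pq assms(6)])
    show "critical \<Gamma> (W i) (k i) (f i)" if "i \<in> {1..m}" for i
      using f that by (simp add: k_def)
    fix i x y assume i: "i \<in> {1..m}" and xy: "{x, y} \<in> edges \<Gamma>" "x \<in> W i" "y \<in> U"
    have "x \<in> U" using i xy(2) Union by blast
    then have "{x, y} \<in> edges G" using xy G(3) by simp
    then show "y \<in> W i" using component_edge_closed[OF G(1)] WQ[OF i] xy(2) unfolding Q_def by blast
  qed simp
  \<comment> \<open>For embeddedness, all neighbours of \<open>u\<close> lie in \<open>F\<close>, so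
    \<open>F - {u}\<close> is a cover. An irredundant cover inside it gives a strictly smaller
    associated prime, as \<open>t\<close> is positive and the edge \<open>{p, q}\<close> keeps that
    cover non-empty.\<close>
  have cover: "is_cover \<Gamma> F" and NF: "closed_nbhd \<Gamma> U \<subseteq> F"
    using assms(6) by (auto simp: minimal_cover_containing_def)
  have "is_cover \<Gamma> (F - {u})"
    using u NF by (intro cover_remove[OF assms(1) cover]) (auto simp: closed_nbhd_def)
  then obtain F' where F': "F' \<subseteq> F - {u}" "is_cover \<Gamma> F'" "\<And>v. v \<in> F' \<Longrightarrow> \<not> is_cover \<Gamma> (F' - {v})"
    using exists_irredundant_cover[of \<Gamma> "F - {u}"] by blast
  have "F' \<noteq> {}" using F'(2) pq(3) by (auto simp: is_cover_def)
  then have "var_ideal F' \<in> associated_primes (mpoly_ring :: ('v, 'k) mpoly ring) (ideal_power mpoly_ring I t)"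
    unfolding assms(3) t using associated_prime_minimal_cover[OF assms(1) F'(2,3), of "(\<Sum>i=1..m. k i) + d"] by simp
  moreover have "F' \<subset> F" using F'(1) u NF by (auto simp: closed_nbhd_def)
  then have "(var_ideal F' :: ('v, 'k) mpoly set) \<subset> var_ideal F" by (rule var_ideal_psubset)
  ultimately show ?thesis using P unfolding embedded_associated_prime_def by blast
qed

end
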